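(* Let $f:X\to Y$ be a $\kappa$-pseudo open map between Tychonoff spaces $X$ and $Y$. (i) If $X$ is open-compact attainable, then so is $Y$. (ii) If $X$ is $\kappa$-Fréchet--Urysohn, then so is $Y$.
   Context: All topological spaces are assumed to be Tychonoff. A continuous surjective map $f:X\to Y$ is called $\kappa$-pseudo open if whenever $y\in Y$, $U$ is open in $X$ and $f^{-1}(y)\subseteq U$, then $y\in\operatorname{Int}\big(\overline{f(U)}\big)$. A space $X$ is open-compact attainable if for every open $W\subseteq X$ and every $z\in\overline{W}$ there is a compact $K\subseteq X$ such that $z\in K\cap\overline{K\cap W}$. A space $X$ is $\kappa$-Fréchet--Urysohn if for every open $U\subseteq X$ and every $x\in\overline{U}$ there is a sequence $\{x_n\}_{n\in\omega}\subseteq U$ converging to $x$. *)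

theory Defs
  imports "HOL-Analysis.Analysis"
begin

definition tychonoff_space :: "'a topology \<Rightarrow> bool" where
  "tychonoff_space X \<longleftrightarrow> completely_regular_space X \<and> t1_space X"

definition kappa_pseudo_open_map :: "'a topology \<Rightarrow> 'b topology \<Rightarrow> ('a \<Rightarrow> 'b) \<Rightarrow> bool" where
  "kappa_pseudo_open_map X Y f \<longleftrightarrow>
     continuous_map X Y f \<and> f ` topspace X = topspace Y \<and>
     (\<forall>y\<in>topspace Y. \<forall>U. openin X U \<and> {x \<in> topspace X. f x = y} \<subseteq> U \<longrightarrow>
        y \<in> Y interior_of (Y closure_of (f ` U)))"

definition open_compact_attainable :: "'a topology \<Rightarrow> bool" where
  "open_compact_attainable X \<longleftrightarrow>
     (\<forall>W. openin X W \<longrightarrow> (\<forall>z \<in> X closure_of W.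
        \<exists>K. compactin X K \<and> z \<in> K \<inter> X closure_of (K \<inter> W)))"

definition kappa_Frechet_Urysohn :: "'a topology \<Rightarrow> bool" where
  "kappa_Frechet_Urysohn X \<longleftrightarrow>
     (\<forall>U. openin X U \<longrightarrow> (\<forall>x \<in> X closure_of U.
        \<exists>s :: nat \<Rightarrow> 'a. range s \<subseteq> U \<and> limitin X s x sequentially))"

end

theory Submission
  imports Defs
begin

text \<open>If the fibre of \<open>z\<close> missed the closure of the preimage \<open>V\<close> of \<open>W\<close>, then the complement
  \<open>U\<close> of that closure would be a neighbourhood of the fibre whose image misses \<open>W\<close>, although the
  interior of the closure of that image is a neighbourhood of \<open>z\<close>. So each closure point of \<open>W\<close>
  lifts to a closure point of \<open>V\<close>; the compact set or sequence found there is mapped forward by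
  the map.\<close>

lemma kappa_pseudo_open_map_lift_closure:
  assumes f: "kappa_pseudo_open_map X Y f" and W: "openin Y W" and z: "z \<in> Y closure_of W"
  obtains x where "x \<in> X closure_of {x \<in> topspace X. f x \<in> W}" "f x = z"
proof (rule ccontr)
  assume "\<not> thesis"
  define V where "V = {x \<in> topspace X. f x \<in> W}"
  define U where "U = topspace X - X closure_of V"
  have V: "V \<subseteq> topspace X"
    by (auto simp: V_def)
  have U: "openin X U"
    by (simp add: U_def openin_diff)
  have fibre: "{x \<in> topspace X. f x = z} \<subseteq> U"
    using \<open>\<not> thesis\<close> that by (auto simp: U_def V_def)
  have zY: "z \<in> topspace Y"
    using z by (simp add: in_closure_of)
  have "z \<in> Y interior_of (Y closure_of (f ` U))"
    using f U fibre zY unfolding kappa_pseudo_open_map_def by blast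
  \<comment> \<open>The interior is an open neighbourhood of \<open>z\<close>, and \<open>z\<close>
    is a closure point of \<open>W\<close>.\<close>
  then have "W \<inter> Y interior_of (Y closure_of (f ` U)) \<noteq> {}"
    using z by (metis IntI empty_iff in_closure_of openin_interior_of)
  then have "W \<inter> Y closure_of (f ` U) \<noteq> {}"
    using interior_of_subset by fastforce
  \<comment> \<open>An open set that meets the closure of a set meets the set itself; this is where
    openness of \<open>W\<close> enters.\<close>
  then have "W \<inter> f ` U \<noteq> {}"
    using W by (simp add: openin_Int_closure_of_eq_empty)
  \<comment> \<open>A point of \<open>U\<close> with image in \<open>W\<close> lies in
    \<open>V\<close>, hence in the closure of \<open>V\<close>, which \<open>U\<close>
    avoids.\<close>
  then show False
    using closure_of_subset[OF V] by (auto simp: U_def V_def)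
qed

lemma open_compact_attainable_kappa_pseudo_open_image:
  assumes f: "kappa_pseudo_open_map X Y f" and X: "open_compact_attainable X"
  shows "open_compact_attainable Y"
  unfolding open_compact_attainable_def
proof (intro allI impI ballI)
  fix W z
  assume W: "openin Y W" and z: "z \<in> Y closure_of W"
  define V where "V = {x \<in> topspace X. f x \<in> W}"
  obtain x where x: "x \<in> X closure_of V" "f x = z"
    using kappa_pseudo_open_map_lift_closure[OF f W z] unfolding V_def .
  have cont: "continuous_map X Y f"
    using f by (simp add: kappa_pseudo_open_map_def)
  have "openin X V"
    using cont W by (simp add: V_def openin_continuous_map_preimage)
  then obtain K where K: "compactin X K" "x \<in> K" "x \<in> X closure_of (K \<inter> V)"
    using X x(1) unfolding open_compact_attainable_def by blast
  have "z \<in> Y closure_of (f ` (K \<inter> V))"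
    using continuous_map_image_closure_subset[OF cont] K(3) x(2) by blast
  moreover have "f ` (K \<inter> V) \<subseteq> f ` K \<inter> W"
    by (auto simp: V_def)
  ultimately have "z \<in> Y closure_of (f ` K \<inter> W)"
    using closure_of_mono by blast
  then show "\<exists>K. compactin Y K \<and> z \<in> K \<inter> Y closure_of (K \<inter> W)"
    using image_compactin[OF K(1) cont] K(2) x(2) by blast
qed

text \<open>A sequence in \<open>V\<close> converging to the lifted point \<open>x\<close> is sent
  by \<open>f\<close> into \<open>W\<close>, and continuity makes its image converge to
  \<open>z\<close>.\<close>

lemma kappa_Frechet_Urysohn_kappa_pseudo_open_image:
  assumes f: "kappa_pseudo_open_map X Y f" and X: "kappa_Frechet_Urysohn X"
  shows "kappa_Frechet_Urysohn Y"
  unfolding kappa_Frechet_Urysohn_def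
proof (intro allI impI ballI)
  fix W z
  assume W: "openin Y W" and z: "z \<in> Y closure_of W"
  define V where "V = {x \<in> topspace X. f x \<in> W}"
  obtain x where x: "x \<in> X closure_of V" "f x = z"
    using kappa_pseudo_open_map_lift_closure[OF f W z] unfolding V_def .
  have cont: "continuous_map X Y f"
    using f by (simp add: kappa_pseudo_open_map_def)
  have "openin X V"
    using cont W by (simp add: V_def openin_continuous_map_preimage)
  then obtain s :: "nat \<Rightarrow> 'a" where s: "range s \<subseteq> V" "limitin X s x sequentially"
    using X x(1) unfolding kappa_Frechet_Urysohn_def by blast
  have "range (f \<circ> s) \<subseteq> W"
    using s(1) by (auto simp: V_def)
  moreover have "limitin Y (f \<circ> s) z sequentially"
    using continuous_map_limit[OF cont s(2)] x(2) by simp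
  ultimately show "\<exists>t :: nat \<Rightarrow> 'b. range t \<subseteq> W \<and> limitin Y t z sequentially"
    by blast
qed

theorem proposition4p6:
  fixes X :: "'a topology" and Y :: "'b topology" and f :: "'a \<Rightarrow> 'b"
  assumes "tychonoff_space X" and "tychonoff_space Y"
    and "kappa_pseudo_open_map X Y f"
  shows "(open_compact_attainable X \<longrightarrow> open_compact_attainable Y) \<and>
         (kappa_Frechet_Urysohn X \<longrightarrow> kappa_Frechet_Urysohn Y)"
  using assms(3) open_compact_attainable_kappa_pseudo_open_image
    kappa_Frechet_Urysohn_kappa_pseudo_open_image by blast

end
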